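(* Let $H$ be a finite abelian group of order $n \geq 2$, let $m > 1$ be an integer, and let $k = \gcd(m,n)$. The following statements are equivalent: (1) The graph $m\text{-}G(H)$ is connected. (2) $k \mid n$, and if $p$ is a prime factor of $n$, then $p \mid k$ (and hence $p \mid m$).
   Context: For a finite abelian group $H$ and an integer $m>1$, the $m$-graph of $H$, denoted $m\text{-}G(H)$, is the simple undirected graph with vertex set $H$ in which two distinct vertices $a,b\in H$ are adjacent if and only if $a^m=b$ or $b^m=a$ (multiplicative notation for powers; in additive notation $ma=b$ or $mb=a$). *)

theory Defs
  imports
    "HOL-Algebra.Coset"
    "HOL-Computational_Algebra.Primes"
    "Graph_Theory.Graph_Theory"
begin

(* A simple undirected graph is represented, as usual in Graph_Theory, by a symmetric loop-free
   digraph: an edge {a, b} is the pair of arcs (a, b) and (b, a). *)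
definition m_graph :: "nat \<Rightarrow> ('a, 'b) monoid_scheme \<Rightarrow> 'a pair_pre_digraph" where
  "m_graph m H =
     \<lparr> pverts = carrier H,
       parcs = {(a, b). a \<in> carrier H \<and> b \<in> carrier H \<and> a \<noteq> b \<and>
                        (a [^]\<^bsub>H\<^esub> m = b \<or> b [^]\<^bsub>H\<^esub> m = a)} \<rparr>"

lemma pair_graph_m_graph:
  assumes "finite (carrier H)"
  shows "pair_graph (m_graph m H)"
proof
  have "parcs (m_graph m H) \<subseteq> carrier H \<times> carrier H"
    by (auto simp: m_graph_def)
  then show "finite (parcs (m_graph m H))"
    using assms finite_subset by blast
  show "symmetric (with_proj (m_graph m H))"
    by (auto simp: symmetric_def sym_def m_graph_def)
qed (use assms in \<open>auto simp: m_graph_def\<close>)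

end

theory Submission
  imports Defs "HOL-Algebra.Sylow" "HOL-Algebra.Multiplicative_Group"
begin

text \<open>
  Following the edges \<open>x, x\<^sup>m, (x\<^sup>m)\<^sup>m, \<dots>\<close> from a vertex visits the powers \<open>x [^] (m ^ i)\<close>.
  Call \<open>x\<close> an \<open>m\<close>-torsion element if one of these powers is the identity. An edge always joins
  some \<open>x\<close> to \<open>x\<^sup>m\<close>, and \<open>x\<close> is \<open>m\<close>-torsion exactly when \<open>x\<^sup>m\<close> is; so the \<open>m\<close>-torsion elements
  are precisely the component of the identity, and the graph is connected iff every element is
  \<open>m\<close>-torsion (lemma \<open>connected_m_graph_iff\<close>).

  This has an arithmetic reformulation (lemma \<open>all_torsion_iff_prime_divisors_dvd\<close>): the order of an
  \<open>m\<close>-torsion element divides a power of \<open>m\<close>. By Cauchy's theorem every prime divisor \<open>p\<close> of the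
  group order \<open>n\<close> is the order of an element, so if all elements are \<open>m\<close>-torsion, \<open>p\<close> divides a power of
  \<open>m\<close> and hence \<open>m\<close>. Conversely, if every prime divisor of \<open>n\<close> divides \<open>m\<close>, then \<open>n\<close> divides
  a power of \<open>m\<close>, and that power annihilates the whole group by Lagrange's theorem. For a prime \<open>p\<close>
  dividing \<open>n\<close>, dividing \<open>m\<close> is the same as dividing \<open>gcd m n\<close>.
\<close>

text \<open>
  Split off one prime factor at a time: each contributes one further factor \<open>m\<close>.
\<close>

lemma dvd_power_if_prime_divisors_dvd:
  fixes n m :: nat
  assumes "n > 0" and "\<And>p. prime p \<Longrightarrow> p dvd n \<Longrightarrow> p dvd m"
  shows "\<exists>i. n dvd m ^ i"
  using assms
proof (induction n rule: less_induct)
  case (less n)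
  show ?case
  proof (cases "n = 1")
    case True
    then show ?thesis by simp
  next
    case False
    then obtain p where p: "prime p" "p dvd n"
      using prime_factor_nat by blast
    then obtain q where n: "n = p * q" by (elim dvdE)
    have "q < n" "q > 0"
      using n less.prems(1) prime_gt_1_nat[OF p(1)] by auto
    moreover have "\<And>r. prime r \<Longrightarrow> r dvd q \<Longrightarrow> r dvd m"
      using less.prems(2) n by auto
    ultimately obtain i where "q dvd m ^ i"
      using less.IH by blast
    then have "n dvd m ^ Suc i"
      using n p less.prems(2)[of p] by (simp add: mult_dvd_mono)
    then show ?thesis ..
  qed
qed

text \<open>
  Cauchy's theorem. The instance of Sylow's theorem with exponent 1 gives a subgroup with
  \<open>p\<close> elements, and by Lagrange any of its non-identity elements has order \<open>p\<close>.
\<close>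

lemma (in group) exists_ord_eq_prime:
  assumes fin: "finite (carrier G)" and p: "prime p" "p dvd order G"
  shows "\<exists>x\<in>carrier G. ord x = p"
proof -
  obtain q where "order G = p ^ 1 * q" using p(2) by (auto elim: dvdE)
  from sylow_thm[OF p(1) is_group this fin]
  obtain P where P: "subgroup P G" "card P = p" by auto
  interpret P: group "G\<lparr>carrier := P\<rparr>"
    using P(1) by (rule subgroup.subgroup_is_group) (rule is_group)
  have "\<not> P \<subseteq> {\<one>}"
    using P(2) prime_gt_1_nat[OF p(1)] card_mono[of "{\<one>}" P] by auto
  then obtain x where x: "x \<in> P" "x \<noteq> \<one>" by auto
  have xG: "x \<in> carrier G" using subgroup.mem_carrier[OF P(1) x(1)] .
  have "x [^]\<^bsub>G\<lparr>carrier := P\<rparr>\<^esub> order (G\<lparr>carrier := P\<rparr>) = \<one>\<^bsub>G\<lparr>carrier := P\<rparr>\<^esub>"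
    by (rule P.pow_order_eq_1) (use x(1) in simp)
  then have "x [^] p = \<one>"
    using P(2) by (simp add: order_def nat_pow_def)
  then have "ord x dvd p" using pow_eq_id xG by blast
  moreover have "ord x \<noteq> 1" using ord_eq_1[OF xG] x(2) by simp
  ultimately have "ord x = p" using p(1) by (auto simp: prime_nat_iff)
  then show ?thesis using xG by blast
qed

lemma (in group) all_torsion_iff_prime_divisors_dvd:
  assumes fin: "finite (carrier G)"
  shows "(\<forall>x\<in>carrier G. \<exists>i. x [^] (m ^ i) = \<one>) \<longleftrightarrow> (\<forall>p. prime p \<and> p dvd order G \<longrightarrow> p dvd m)"
proof (intro iffI allI impI ballI)
  fix p :: nat
  assume torsion: "\<forall>x\<in>carrier G. \<exists>i. x [^] (m ^ i) = \<one>" and p: "prime p \<and> p dvd order G"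
  obtain x where x: "x \<in> carrier G" "ord x = p"
    using exists_ord_eq_prime[OF fin] p by blast
  obtain i where "x [^] (m ^ i) = \<one>" using torsion x(1) by blast
  then have "p dvd m ^ i" using pow_eq_id[OF x(1)] x(2) by simp
  then show "p dvd m" using p prime_dvd_power by blast
next
  fix x
  assume primes: "\<forall>p. prime p \<and> p dvd order G \<longrightarrow> p dvd m" and x: "x \<in> carrier G"
  have "order G > 0" using fin order_gt_0_iff_finite by blast
  then obtain i where "order G dvd m ^ i"
    using dvd_power_if_prime_divisors_dvd primes by blast
  then have "ord x dvd m ^ i" using ord_dvd_group_order[OF x] dvd_trans by blast
  then show "\<exists>i. x [^] (m ^ i) = \<one>" using pow_eq_id[OF x] by blast
qed

text \<open>
  An edge of the graph joins some \<open>x\<close> to \<open>x [^] m\<close>, so this invariance makes the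
  \<open>m\<close>-torsion elements a union of components.
\<close>

lemma (in group) torsion_pow_iff:
  fixes m :: nat
  assumes x: "x \<in> carrier G"
  shows "(\<exists>i. (x [^] m) [^] (m ^ i) = \<one>) \<longleftrightarrow> (\<exists>i. x [^] (m ^ i) = \<one>)"
proof
  assume "\<exists>i. (x [^] m) [^] (m ^ i) = \<one>"
  then obtain i where "x [^] (m ^ Suc i) = \<one>" using x by (auto simp: nat_pow_pow)
  then show "\<exists>i. x [^] (m ^ i) = \<one>" ..
next
  assume "\<exists>i. x [^] (m ^ i) = \<one>"
  then obtain i where "x [^] (m ^ i) = \<one>" ..
  then have "(x [^] (m ^ i)) [^] m = \<one>" by simp
  then show "\<exists>i. (x [^] m) [^] (m ^ i) = \<one>"
    using x by (auto simp: nat_pow_pow mult.commute)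
qed

lemma reachable_pow_in_m_graph:
  assumes "group H" and fin: "finite (carrier H)" and x: "x \<in> carrier H"
  shows "x \<rightarrow>\<^sup>*\<^bsub>with_proj (m_graph m H)\<^esub> (x [^]\<^bsub>H\<^esub> (m ^ i))"
proof -
  interpret group H by fact
  interpret pair_graph "m_graph m H" using fin by (rule pair_graph_m_graph)
  show ?thesis
  proof (induction i)
    case 0
    have "x \<in> verts (with_proj (m_graph m H))" using x by (simp add: m_graph_def)
    then show ?case using x by (simp add: reachable_refl)
  next
    case (Suc i)
    let ?y = "x [^]\<^bsub>H\<^esub> (m ^ i)"
    have y: "?y \<in> carrier H" using x by simp
    have next_pow: "x [^]\<^bsub>H\<^esub> (m ^ Suc i) = ?y [^]\<^bsub>H\<^esub> m"
      using x by (simp add: nat_pow_pow mult.commute)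
    show ?case
    \<comment> \<open>The graph has no loops, so a fixed point of the \<open>m\<close>-th power map yields no edge.\<close>
    proof (cases "?y [^]\<^bsub>H\<^esub> m = ?y")
      case True
      then show ?thesis using Suc next_pow by simp
    next
      case False
      then have "?y \<rightarrow>\<^bsub>with_proj (m_graph m H)\<^esub> (?y [^]\<^bsub>H\<^esub> m)"
        using y by (auto simp: m_graph_def)
      with Suc show ?thesis unfolding next_pow
        using wf_digraph.reachable_adj_trans[OF wf_digraph] by blast
    qed
  qed
qed

lemma connected_m_graph_iff:
  assumes "group H" and fin: "finite (carrier H)"
  shows "connected (with_proj (m_graph m H)) \<longleftrightarrow>
    (\<forall>x\<in>carrier H. \<exists>i. x [^]\<^bsub>H\<^esub> (m ^ i) = \<one>\<^bsub>H\<^esub>)"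
proof -
  interpret group H by fact
  interpret pair_graph "m_graph m H" using fin by (rule pair_graph_m_graph)
  let ?\<Gamma> = "with_proj (m_graph m H)"
  let ?torsion = "\<lambda>x. \<exists>i. x [^]\<^bsub>H\<^esub> (m ^ i) = \<one>\<^bsub>H\<^esub>"
  have sym: "symmetric ?\<Gamma>" by (rule sym_arcs)
  have verts: "verts ?\<Gamma> = carrier H" by (simp add: m_graph_def)
  have conn: "connected ?\<Gamma> \<longleftrightarrow> (\<forall>u\<in>carrier H. \<forall>v\<in>carrier H. u \<rightarrow>\<^sup>*\<^bsub>?\<Gamma>\<^esub> v)"
    using verts one_closed
    by (auto simp: connected_def strongly_connected_def reachable_mk_symmetric_eq[OF sym])
  show ?thesis
  proof
    assume "connected ?\<Gamma>"
    show "\<forall>x\<in>carrier H. ?torsion x"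
    proof
      fix x assume "x \<in> carrier H"
      then have "\<one>\<^bsub>H\<^esub> \<rightarrow>\<^sup>*\<^bsub>?\<Gamma>\<^esub> x" using \<open>connected ?\<Gamma>\<close> conn by blast
      then show "?torsion x"
      proof (induction rule: reachable_induct)
        case base
        then show ?case by simp
      next
        case (step a b)
        from step.hyps(2)
        have ab: "a \<in> carrier H" "b \<in> carrier H" and "a [^]\<^bsub>H\<^esub> m = b \<or> b [^]\<^bsub>H\<^esub> m = a"
          by (auto simp: m_graph_def)
        from this(3) show ?case
        proof
          assume "a [^]\<^bsub>H\<^esub> m = b"
          then show ?case using torsion_pow_iff[OF ab(1), of m] step.IH by blast
        next
          assume "b [^]\<^bsub>H\<^esub> m = a"
          then show ?case using torsion_pow_iff[OF ab(2), of m] step.IH by blast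
        qed
      qed
    qed
  next
    assume torsion: "\<forall>x\<in>carrier H. ?torsion x"
    have to_one: "x \<rightarrow>\<^sup>*\<^bsub>?\<Gamma>\<^esub> \<one>\<^bsub>H\<^esub>" if "x \<in> carrier H" for x
    proof -
      from bspec[OF torsion that] obtain i where "x [^]\<^bsub>H\<^esub> (m ^ i) = \<one>\<^bsub>H\<^esub>" ..
      then show ?thesis using reachable_pow_in_m_graph[OF \<open>group H\<close> fin that, of m i] by simp
    qed
    show "connected ?\<Gamma>"
    proof (rule iffD2[OF conn], intro ballI)
      fix u v assume uv: "u \<in> carrier H" "v \<in> carrier H"
      show "u \<rightarrow>\<^sup>*\<^bsub>?\<Gamma>\<^esub> v"
        by (rule wf_digraph.reachable_trans[OF wf_digraph to_one[OF uv(1)]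
              symmetric_reachable[OF sym to_one[OF uv(2)]]])
    qed
  qed
qed

theorem theorem2p2:
  fixes H :: "('a, 'b) monoid_scheme" and m n k :: nat
  assumes "comm_group H"
    and "finite (carrier H)"
    and "n = order H"
    and "n \<ge> 2"
    and "m > 1"
    and "k = gcd m n"
  shows "(connected (with_proj (m_graph m H)) \<longleftrightarrow>
            k dvd n \<and> (\<forall>p. p \<in> prime_factors n \<longrightarrow> p dvd k)) \<and>
         (\<forall>p. p \<in> prime_factors n \<and> p dvd k \<longrightarrow> p dvd m)"
proof -
  interpret comm_group H by fact
  have "connected (with_proj (m_graph m H)) \<longleftrightarrow> (\<forall>p. prime p \<and> p dvd n \<longrightarrow> p dvd m)"
    using connected_m_graph_iff[OF is_group assms(2)] all_torsion_iff_prime_divisors_dvd[OF assms(2)]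
      \<open>n = order H\<close> by simp
  moreover have "p \<in> prime_factors n \<longleftrightarrow> prime p \<and> p dvd n" for p
    using \<open>n \<ge> 2\<close> by (auto simp: prime_factors_dvd)
  ultimately show ?thesis
    using \<open>k = gcd m n\<close> by auto
qed

end
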